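(* Let $X$ be a finite domain and ${\mathcal B}({\mathcal D},D)$ a decision problem over a class of distributions ${\mathcal D}$ on $X$ with reference distribution $D$. Let $\kappa>0$, $d={\rm SDN}({\mathcal B}({\mathcal D},D),\kappa)$, and let ${\mathcal D}_D$ be a set of distributions for which the value $d$ is attained. Consider the average-case version of ${\mathcal B}({\mathcal D},D)$ in which the input distribution $D'$ equals $D$ with probability $1/2$ and equals a uniformly random element of ${\mathcal D}_D$ with probability $1/2$. Any randomized statistical algorithm that solves this problem with success probability $\gamma>1/2$ (over the choice of $D'$ and the algorithm's randomness) requires at least $(2\gamma-1)d$ calls to ${\rm VSTAT}(1/(3\kappa^2))$.
   Context: ${\mathcal B}({\mathcal D},D)$: given access to an unknown $D'\in{\mathcal D}\cup\{D\}$, decide whether $D'\in{\mathcal D}$ or $D'=D$. Discrimination norm: $\kappa_2({\mathcal D}',D)=\max_{h:X\to\mathbb{R},\ \mathbb{E}_D[h^2]=1}\mathbb{E}_{D''\sim{\mathcal D}'}|\mathbb{E}_{D''}[h]-\mathbb{E}_D[h]|$ ($D''$ uniform over ${\mathcal D}'$). ${\rm SDN}({\mathcal B}({\mathcal D},D),\kappa)$ is the largest integer $d$ such that there is a finite ${\mathcal D}_D\subseteq{\mathcal D}$ with $\kappa_2({\mathcal D}',D)\le\kappa$ for every ${\mathcal D}'\subseteq{\mathcal D}_D$ with $|{\mathcal D}'|\ge|{\mathcal D}_D|/d$. ${\rm VSTAT}(t)$ for input distribution $P$: given $h:X\to\{0,1\}$, returns some $v$ with $|v-p|\le\max\{1/t,\sqrt{p(1-p)/t}\}$,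 $p=\mathbb{E}_P[h]$, otherwise arbitrary (possibly adversarial); a statistical algorithm accesses the input only via such queries and must succeed for every valid sequence of answers. *)

theory Defs
  imports "HOL-Probability.Probability"
begin

text \<open>
  The finite domain is a type \<open>'x\<close> of class \<open>finite\<close>; distributions on it are of type \<open>'x pmf\<close>.
\<close>

text \<open>
  The discrimination norm is taken in \<open>ereal\<close>: if some member of \<open>\<D>'\<close> charges a point outside
  the support of \<open>D\<close>, the admissible functions make the expression arbitrarily large and the value
  is \<open>\<infinity>\<close>. In all other cases the supremum is finite and attained.
\<close>

definition kappa2 :: "'x::finite pmf set \<Rightarrow> 'x pmf \<Rightarrow> ereal" where
  "kappa2 \<D>' D =
     (SUP h\<in>{h :: 'x \<Rightarrow> real. measure_pmf.expectation D (\<lambda>x. (h x)\<^sup>2) = 1}.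
        ereal (measure_pmf.expectation (pmf_of_set \<D>')
          (\<lambda>P. \<bar>measure_pmf.expectation P h - measure_pmf.expectation D h\<bar>)))"

definition sdn_attained_by ::
  "'x::finite pmf set \<Rightarrow> 'x pmf \<Rightarrow> real \<Rightarrow> nat \<Rightarrow> 'x pmf set \<Rightarrow> bool" where
  "sdn_attained_by \<D> D \<kappa> d \<D>\<^sub>D \<longleftrightarrow>
     d \<ge> 1 \<and> finite \<D>\<^sub>D \<and> \<D>\<^sub>D \<noteq> {} \<and> \<D>\<^sub>D \<subseteq> \<D> \<and>
     (\<forall>\<D>'\<subseteq>\<D>\<^sub>D. real (card \<D>') \<ge> real (card \<D>\<^sub>D) / real d \<longrightarrow> kappa2 \<D>' D \<le> ereal \<kappa>)"

text \<open>
  The value is \<open>\<infinity>\<close> if arbitrarily large \<open>d\<close> are admissible, and \<open>0\<close> if no \<open>d \<ge> 1\<close> is.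
  If \<open>D \<in> \<D>\<close> and \<open>\<kappa> \<ge> 0\<close>, the set \<open>{D}\<close> shows that the value is \<open>\<infinity>\<close>; a finite value
  therefore implies that the decision problem is unambiguous.
\<close>

definition SDN :: "'x::finite pmf set \<Rightarrow> 'x pmf \<Rightarrow> real \<Rightarrow> enat" where
  "SDN \<D> D \<kappa> = (SUP d\<in>{d. \<exists>\<D>\<^sub>D. sdn_attained_by \<D> D \<kappa> d \<D>\<^sub>D}. enat d)"

type_synonym 'x query = "'x \<Rightarrow> bool"

definition vstat_answer :: "real \<Rightarrow> 'x pmf \<Rightarrow> 'x query \<Rightarrow> real \<Rightarrow> bool" where
  "vstat_answer t P h v \<longleftrightarrow>
     (let p = measure_pmf.expectation P (\<lambda>x. of_bool (h x))
      in \<bar>v - p\<bar> \<le> max (1 / t) (sqrt (p * (1 - p) / t)))"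

text \<open>
  A responder is a strategy, possibly adversarial, for answering queries: its answer may depend on
  all earlier queries and answers (oldest first), so a repeated query may be answered differently.
\<close>

type_synonym 'x responder = "('x query \<times> real) list \<Rightarrow> 'x query \<Rightarrow> real"

definition valid_vstat :: "real \<Rightarrow> 'x pmf \<Rightarrow> 'x responder \<Rightarrow> bool" where
  "valid_vstat t P S \<longleftrightarrow> (\<forall>hist h. vstat_answer t P h (S hist h))"

text \<open>
  A deterministic statistical algorithm maps the answers received so far (oldest first) to its next
  step: another query, or the final decision, where \<open>True\<close> stands for \<open>D' \<in> \<D>\<close> and
  \<open>False\<close> for \<open>D' = D\<close>.
\<close>

datatype 'x step = Query "'x query" | Decide bool

type_synonym 'x stat_alg = "real list \<Rightarrow> 'x step"

text \<open>The queries and answers exchanged within the first \<open>n\<close> steps.\<close>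

primrec transcript :: "'x stat_alg \<Rightarrow> 'x responder \<Rightarrow> nat \<Rightarrow> ('x query \<times> real) list" where
  "transcript A S 0 = []"
| "transcript A S (Suc n) =
     (let ts = transcript A S n in
      case A (map snd ts) of Query h \<Rightarrow> ts @ [(h, S ts h)] | Decide b \<Rightarrow> ts)"

definition decides :: "'x stat_alg \<Rightarrow> 'x responder \<Rightarrow> bool \<Rightarrow> bool" where
  "decides A S b \<longleftrightarrow> (\<exists>n. A (map snd (transcript A S n)) = Decide b)"

text \<open>
  A randomized algorithm is a family of deterministic ones indexed by the outcome of its coins, which
  are drawn from an arbitrary probability space. Since \<open>'x step\<close> is finite, measurability
  of every single step makes all events about runs against a fixed responder measurable.
\<close>

definition randomized_stat_alg :: "'r measure \<Rightarrow> ('r \<Rightarrow> 'x::finite stat_alg) \<Rightarrow> bool" where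
  "randomized_stat_alg M A \<longleftrightarrow>
     prob_space M \<and> (\<forall>as. (\<lambda>\<omega>. A \<omega> as) \<in> measurable M (count_space UNIV))"

definition correct_decision :: "'x pmf set \<Rightarrow> 'x pmf \<Rightarrow> 'x pmf \<Rightarrow> bool \<Rightarrow> bool" where
  "correct_decision \<D> D P b \<longleftrightarrow> (if b then P \<in> \<D> else P = D)"

definition average_case_input :: "'x pmf \<Rightarrow> 'x pmf set \<Rightarrow> 'x pmf pmf" where
  "average_case_input D \<D>\<^sub>D =
     bind_pmf (bernoulli_pmf (1 / 2)) (\<lambda>c. if c then return_pmf D else pmf_of_set \<D>\<^sub>D)"

text \<open>
  The input and the coins are independent. The probability is written as an iterated integral because
  the event need not be measurable in the product space, the type of inputs being uncountable.
\<close>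

definition success_prob ::
  "'x::finite pmf set \<Rightarrow> 'x pmf \<Rightarrow> 'x pmf set \<Rightarrow> 'r measure \<Rightarrow> ('r \<Rightarrow> 'x stat_alg)
     \<Rightarrow> ('x pmf \<Rightarrow> 'x responder) \<Rightarrow> real" where
  "success_prob \<D> D \<D>\<^sub>D M A S =
     measure_pmf.expectation (average_case_input D \<D>\<^sub>D)
       (\<lambda>P. measure M {\<omega> \<in> space M. \<exists>b. decides (A \<omega>) (S P) b \<and> correct_decision \<D> D P b})"

definition solves_average_case ::
  "'x::finite pmf set \<Rightarrow> 'x pmf \<Rightarrow> 'x pmf set \<Rightarrow> real \<Rightarrow> 'r measure \<Rightarrow> ('r \<Rightarrow> 'x stat_alg)
     \<Rightarrow> real \<Rightarrow> bool" where
  "solves_average_case \<D> D \<D>\<^sub>D t M A \<gamma> \<longleftrightarrow>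
     (\<forall>S. (\<forall>P. valid_vstat t P (S P)) \<longrightarrow> success_prob \<D> D \<D>\<^sub>D M A S \<ge> \<gamma>)"

definition calls_at_most ::
  "'x::finite pmf set \<Rightarrow> real \<Rightarrow> 'r measure \<Rightarrow> ('r \<Rightarrow> 'x stat_alg) \<Rightarrow> nat \<Rightarrow> bool" where
  "calls_at_most inputs t M A q \<longleftrightarrow>
     (\<forall>\<omega>\<in>space M. \<forall>P\<in>inputs. \<forall>S. valid_vstat t P S \<longrightarrow> (\<forall>n. length (transcript (A \<omega>) S n) \<le> q))"

end

theory Submission
  imports Defs
begin

text \<open>
  Answer every query with its expectation under \<open>D\<close> whenever this is a valid answer for the input.
  A query \<open>h\<close> is then of use only against those \<open>P\<close> for which the answer is not valid. For such a
  \<open>P\<close>, the difference of the expectations exceeds \<open>\<kappa>\<close> times the standard deviation of \<open>h\<close> under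
  \<open>D\<close>, so the normalised query would witness a discrimination norm above \<open>\<kappa>\<close>. By the choice of
  \<open>\<D>\<^sub>D\<close>, at most a fraction \<open>1 / d\<close> of its members is affected by a single query, and at most a
  fraction \<open>q / d\<close> by a run of the algorithm. On all others the run coincides with the one on \<open>D\<close>.
\<close>

section \<open>Queries as test functions for the discrimination norm\<close>

abbreviation query_mean :: "'x::finite pmf \<Rightarrow> 'x query \<Rightarrow> real" where
  "query_mean P h \<equiv> measure_pmf.expectation P (\<lambda>x. of_bool (h x))"

lemma integrable_finite_type_pmf [simp]:
  fixes P :: "'x::finite pmf" and f :: "'x \<Rightarrow> real"
  shows "integrable (measure_pmf P) f"
  by (rule integrable_measure_pmf_finite) simp

lemma query_mean_bounds: "0 \<le> query_mean P h" "query_mean P h \<le> 1"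
proof -
  show "0 \<le> query_mean P h" by (rule integral_nonneg_AE) simp
  have "query_mean P h \<le> measure_pmf.expectation P (\<lambda>x. 1)"
    by (rule integral_mono) auto
  then show "query_mean P h \<le> 1" by simp
qed

lemma expectation_affine_query:
  "measure_pmf.expectation P (\<lambda>x. a + c * of_bool (h x)) = a + c * query_mean P h"
  by simp

text \<open>The deviation of \<open>h\<close> from its mean is centred, which kills the cross term,
  and a 0/1-valued function of mean r has variance r (1 - r).\<close>

lemma second_moment_affine_query:
  "measure_pmf.expectation P (\<lambda>x. (a + c * (of_bool (h x) - query_mean P h))\<^sup>2)
     = a\<^sup>2 + c\<^sup>2 * (query_mean P h * (1 - query_mean P h))"
proof -
  let ?r = "query_mean P h"
  have "(\<lambda>x. (a + c * (of_bool (h x) - ?r))\<^sup>2)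
      = (\<lambda>x. (a - c * ?r)\<^sup>2 + (2 * (a - c * ?r) * c + c\<^sup>2) * of_bool (h x))"
    by (rule ext) (auto simp: of_bool_def power2_eq_square algebra_simps)
  then have "measure_pmf.expectation P (\<lambda>x. (a + c * (of_bool (h x) - ?r))\<^sup>2)
      = (a - c * ?r)\<^sup>2 + (2 * (a - c * ?r) * c + c\<^sup>2) * ?r"
    by (simp only: expectation_affine_query)
  also have "\<dots> = a\<^sup>2 + c\<^sup>2 * (?r * (1 - ?r))"
    by (simp add: power2_eq_square algebra_simps)
  finally show ?thesis .
qed

text \<open>The condition on \<open>a\<close> and \<open>c\<close> says that a + c (h - r), with r
  the mean of \<open>h\<close> under \<open>D\<close>, is admissible in the norm. In differences of
  expectations the constant cancels and \<open>c\<close> factors out. A free \<open>a\<close> covers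
  queries of variance zero, which scaling alone cannot normalise.\<close>

lemma kappa2_affine_query:
  assumes fin: "finite \<D>'" "\<D>' \<noteq> {}"
    and norm: "a\<^sup>2 + c\<^sup>2 * (query_mean D h * (1 - query_mean D h)) = 1"
    and \<kappa>: "kappa2 \<D>' D \<le> ereal \<kappa>"
  shows "\<bar>c\<bar> * (\<Sum>P\<in>\<D>'. \<bar>query_mean P h - query_mean D h\<bar>) \<le> \<kappa> * card \<D>'"
proof -
  let ?r = "query_mean D h"
  let ?f = "\<lambda>x. a + c * (of_bool (h x) - ?r)"
  have E: "measure_pmf.expectation P ?f = a - c * ?r + c * query_mean P h" for P
  proof -
    have "?f = (\<lambda>x. (a - c * ?r) + c * of_bool (h x))"
      by (rule ext) (simp add: algebra_simps)
    then show ?thesis by (simp only: expectation_affine_query)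
  qed
  have "ereal (measure_pmf.expectation (pmf_of_set \<D>')
          (\<lambda>P. \<bar>measure_pmf.expectation P ?f - measure_pmf.expectation D ?f\<bar>)) \<le> kappa2 \<D>' D"
    unfolding kappa2_def
    by (rule SUP_upper) (simp only: mem_Collect_eq second_moment_affine_query norm)
  with \<kappa> have "ereal (measure_pmf.expectation (pmf_of_set \<D>')
          (\<lambda>P. \<bar>measure_pmf.expectation P ?f - measure_pmf.expectation D ?f\<bar>)) \<le> ereal \<kappa>"
    by (rule order_trans[rotated])
  then have "measure_pmf.expectation (pmf_of_set \<D>')
          (\<lambda>P. \<bar>measure_pmf.expectation P ?f - measure_pmf.expectation D ?f\<bar>) \<le> \<kappa>"
    by simp
  then have "(\<Sum>P\<in>\<D>'. \<bar>(a - c * ?r + c * query_mean P h) - (a - c * ?r + c * ?r)\<bar>) / card \<D>' \<le> \<kappa>"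
    unfolding E integral_pmf_of_set[OF fin(2,1)] .
  moreover have "\<bar>(a - c * ?r + c * query_mean P h) - (a - c * ?r + c * ?r)\<bar>
      = \<bar>c\<bar> * \<bar>query_mean P h - ?r\<bar>" for P
    by (simp add: abs_mult[symmetric] algebra_simps)
  moreover have "0 < card \<D>'"
    using fin by (simp add: card_gt_0_iff)
  ultimately show ?thesis
    by (simp add: sum_distrib_left divide_le_eq)
qed

text \<open>The tolerance refers to the variance p (1 - p) under the input, the norm to r (1 - r)
  under \<open>D\<close>. These differ by at most the gap \<Delta>, and the two parts of the
  tolerance make both 3 \<kappa>^2 p (1 - p) and 3 \<kappa>^2 \<Delta> smaller than \<Delta>^2. The
  sum is below 3 \<Delta>^2, which accounts for the constant 3.\<close>

lemma invalid_answer_gap: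
  fixes p r \<kappa> :: real
  assumes "0 \<le> r" "r \<le> 1" "\<kappa> > 0" "0 \<le> p" "p \<le> 1"
    and gap: "\<bar>r - p\<bar> > max (1 / (1 / (3 * \<kappa>\<^sup>2))) (sqrt (p * (1 - p) / (1 / (3 * \<kappa>\<^sup>2))))"
  shows "\<kappa> * sqrt (r * (1 - r)) < \<bar>p - r\<bar>"
proof -
  define \<Delta> where "\<Delta> = \<bar>p - r\<bar>"
  have \<Delta>1: "3 * \<kappa>\<^sup>2 < \<Delta>" and s: "sqrt (3 * \<kappa>\<^sup>2 * (p * (1 - p))) < \<Delta>"
    using gap by (auto simp: \<Delta>_def abs_minus_commute mult_ac)
  have pos: "0 < \<Delta>" using \<Delta>1 \<open>\<kappa> > 0\<close> by (smt (verit) zero_le_power2)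
  have nn: "0 \<le> 3 * \<kappa>\<^sup>2 * (p * (1 - p))" using assms by simp
  then have \<Delta>2: "3 * \<kappa>\<^sup>2 * (p * (1 - p)) < \<Delta>\<^sup>2"
    using s pos by (metis real_sqrt_less_iff real_sqrt_abs abs_of_pos)
  \<comment> \<open>The difference of the variances factors, and |1 - p - r| is at most 1 for p and
    r in [0, 1].\<close>
  have "r * (1 - r) = p * (1 - p) + (r - p) * (1 - p - r)" by (simp add: algebra_simps)
  also have "(r - p) * (1 - p - r) \<le> \<bar>r - p\<bar> * \<bar>1 - p - r\<bar>"
    by (metis abs_ge_self abs_mult)
  also have "\<dots> \<le> \<bar>r - p\<bar> * 1"
    using assms by (intro mult_left_mono) auto
  finally have var: "r * (1 - r) \<le> p * (1 - p) + \<Delta>" by (simp add: \<Delta>_def abs_minus_commute)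
  have "3 * \<kappa>\<^sup>2 * \<Delta> < \<Delta>\<^sup>2"
    using \<Delta>1 pos by (simp add: power2_eq_square)
  moreover have "3 * \<kappa>\<^sup>2 * (r * (1 - r)) \<le> 3 * \<kappa>\<^sup>2 * (p * (1 - p)) + 3 * \<kappa>\<^sup>2 * \<Delta>"
    using mult_left_mono[OF var, of "3 * \<kappa>\<^sup>2"] by (simp add: algebra_simps)
  moreover have "0 < \<Delta>\<^sup>2" using pos by simp
  ultimately have "\<kappa>\<^sup>2 * (r * (1 - r)) < \<Delta>\<^sup>2"
    using \<Delta>2 by linarith
  then have "(\<kappa> * sqrt (r * (1 - r)))\<^sup>2 < \<Delta>\<^sup>2"
    using assms by (simp add: power_mult_distrib)
  then show ?thesis
    using pos unfolding \<Delta>_def by (simp add: power2_less_imp_less)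
qed

definition distinguished :: "real \<Rightarrow> 'x::finite pmf \<Rightarrow> 'x query \<Rightarrow> 'x pmf set" where
  "distinguished t D h = {P. \<not> vstat_answer t P h (query_mean D h)}"

text \<open>All deviations exceed \<kappa> times the standard deviation of \<open>h\<close> under
  \<open>D\<close>, hence so does their average. If that standard deviation is zero, rescaling makes
  the norm exceed any bound.\<close>

lemma kappa2_distinguished:
  assumes "finite \<D>'" "\<D>' \<noteq> {}" "\<kappa> > 0" and sub: "\<D>' \<subseteq> distinguished (1 / (3 * \<kappa>\<^sup>2)) D h"
  shows "\<not> kappa2 \<D>' D \<le> ereal \<kappa>"
proof
  assume le: "kappa2 \<D>' D \<le> ereal \<kappa>"
  let ?r = "query_mean D h"
  let ?s = "sqrt (?r * (1 - ?r))"
  have gap: "\<kappa> * ?s < \<bar>query_mean P h - ?r\<bar>" if "P \<in> \<D>'" for P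
    using that sub query_mean_bounds[of D h] query_mean_bounds[of P h] \<open>\<kappa> > 0\<close>
    by (intro invalid_answer_gap)
      (auto simp: distinguished_def vstat_answer_def Let_def not_le)
  have var: "0 \<le> ?r * (1 - ?r)" using query_mean_bounds[of D h] by simp
  define m where "m = (\<Sum>P\<in>\<D>'. \<bar>query_mean P h - ?r\<bar>)"
  have "(\<Sum>P\<in>\<D>'. \<kappa> * ?s) < m"
    unfolding m_def using assms(1,2) gap by (rule sum_strict_mono)
  then have m: "\<kappa> * ?s * card \<D>' < m" by (simp add: mult_ac)
  show False
  proof (cases "?r * (1 - ?r) = 0")
    case True
    then have "0 < m" using m by (simp only: real_sqrt_zero mult_zero_left mult_zero_right)
    \<comment> \<open>Here \<open>h\<close> is constant on the support of \<open>D\<close>, so its multiples may be added to \<open>1\<close> freely.\<close>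
    have "\<bar>(\<kappa> * card \<D>' + 1) / m\<bar> * m \<le> \<kappa> * card \<D>'"
      unfolding m_def using True
      by (intro kappa2_affine_query[OF assms(1,2) _ le, of 1]) simp
    moreover have "\<bar>(\<kappa> * card \<D>' + 1) / m\<bar> = (\<kappa> * card \<D>' + 1) / m"
      using \<open>0 < m\<close> \<open>\<kappa> > 0\<close> by (intro abs_of_nonneg) simp
    \<comment> \<open>The scale is chosen so that the left-hand side becomes
      \<open>\<kappa> * card \<D>' + 1\<close>.\<close>
    ultimately show False using \<open>0 < m\<close> by simp
  next
    case False
    then have s: "0 < ?s" using var by (simp only: real_sqrt_gt_0_iff less_le) simp
    \<comment> \<open>The test function is \<open>h\<close>, centred and divided by its standard
      deviation under \<open>D\<close>.\<close>
    have "0\<^sup>2 + (1 / ?s)\<^sup>2 * (?r * (1 - ?r)) = 1"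
      using False var by (simp add: power_divide)
    from kappa2_affine_query[OF assms(1,2) this le]
    have "\<bar>1 / ?s\<bar> * m \<le> \<kappa> * card \<D>'" unfolding m_def .
    then have "m / ?s \<le> \<kappa> * card \<D>'" using s by simp
    then have "m \<le> \<kappa> * card \<D>' * ?s" using s by (simp only: pos_divide_le_eq)
    then show False using m by (simp add: mult_ac)
  qed
qed

text \<open>A larger intersection would be a subset big enough for the defining bound of
  \<open>sdn_attained_by\<close>, against \<open>kappa2_distinguished\<close>.\<close>

lemma card_distinguished:
  assumes "sdn_attained_by \<D> D \<kappa> d \<D>\<^sub>D" "\<kappa> > 0"
  shows "real (card (\<D>\<^sub>D \<inter> distinguished (1 / (3 * \<kappa>\<^sup>2)) D h)) \<le> real (card \<D>\<^sub>D) / real d"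
proof (rule ccontr)
  let ?\<D>' = "\<D>\<^sub>D \<inter> distinguished (1 / (3 * \<kappa>\<^sup>2)) D h"
  assume "\<not> ?thesis"
  then have gt: "real (card \<D>\<^sub>D) / real d < real (card ?\<D>')" by simp
  moreover have "0 \<le> real (card \<D>\<^sub>D) / real d" by simp
  ultimately have "0 < card ?\<D>'" by linarith
  then have "finite ?\<D>'" "?\<D>' \<noteq> {}" by (auto simp: card_gt_0_iff)
  moreover have "kappa2 ?\<D>' D \<le> ereal \<kappa>"
    using assms(1) gt unfolding sdn_attained_by_def by (meson inf_le1 less_imp_le)
  ultimately show False
    using kappa2_distinguished[of ?\<D>' \<kappa> D h] \<open>\<kappa> > 0\<close> by auto
qed

text \<open>Otherwise \<open>{D}\<close> admits every value: its only subset large enough is itself,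
  and there all differences of expectations vanish. The value \<open>Suc d\<close> already exceeds
  the supremum.\<close>

lemma finite_SDN_imp_unambiguous:
  assumes "SDN \<D> D \<kappa> = enat d" "\<kappa> > 0"
  shows "D \<notin> \<D>"
proof
  assume "D \<in> \<D>"
  have "sdn_attained_by \<D> D \<kappa> (Suc d) {D}"
    unfolding sdn_attained_by_def
  proof (intro conjI allI impI)
    fix \<D>' assume "\<D>' \<subseteq> {D}" and c: "real (card {D}) / real (Suc d) \<le> real (card \<D>')"
    have "0 < real (card {D}) / real (Suc d)" by simp
    then have "\<D>' \<noteq> {}" using c by (metis card.empty not_le of_nat_0)
    then have "\<D>' = {D}" using \<open>\<D>' \<subseteq> {D}\<close> by blast
    then show "kappa2 \<D>' D \<le> ereal \<kappa>"
      unfolding kappa2_def using \<open>\<kappa> > 0\<close> by (auto intro!: SUP_least simp: pmf_of_set_singleton)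
  qed (use \<open>D \<in> \<D>\<close> in auto)
  then have "enat (Suc d) \<le> SDN \<D> D \<kappa>"
    unfolding SDN_def by (intro SUP_upper) blast
  then show False using assms(1) by simp
qed

section \<open>Runs of a deterministic algorithm\<close>

lemma transcript_append:
  "\<exists>us. transcript A S (n + k) = transcript A S n @ us"
proof (induction k)
  case (Suc k)
  then show ?case by (auto simp: Let_def split: step.split)
qed simp

lemma transcript_length_or_halted:
  "length (transcript A S n) = n \<or> (\<exists>b. A (map snd (transcript A S n)) = Decide b)"
  by (induction n) (auto simp: Let_def split: step.split)

lemma transcript_halted:
  "A (map snd (transcript A S n)) = Decide b \<Longrightarrow> transcript A S (n + k) = transcript A S n"
  by (induction k) (auto simp: Let_def)

text \<open>Every step before the decision adds one entry, so a transcript with fewer than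
  \<open>n\<close> entries belongs to a run that has halted. This reduces an unbounded existential
  to the inspection of one step.\<close>

lemma decides_iff:
  assumes "length (transcript A S n) < n"
  shows "decides A S b \<longleftrightarrow> A (map snd (transcript A S n)) = Decide b"
proof
  obtain c where c: "A (map snd (transcript A S n)) = Decide c"
    using transcript_length_or_halted[of A S n] assms by auto
  assume "decides A S b"
  then obtain m where m: "A (map snd (transcript A S m)) = Decide b"
    unfolding decides_def by blast
  \<comment> \<open>Both steps lie after halting, so both transcripts agree with the one at
    \<open>n + m\<close>.\<close>
  have "transcript A S (n + m) = transcript A S n" "transcript A S (m + n) = transcript A S m"
    using c m by (auto intro: transcript_halted)
  then show "A (map snd (transcript A S n)) = Decide b"
    using m by (simp add: add.commute)
qed (auto simp: decides_def)

text \<open>Agreement is required only on queries of the run against \<open>S\<close>: inductively,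
  the run against \<open>S'\<close> never asks any other.\<close>

lemma transcript_cong:
  assumes "\<And>hist h v. (h, v) \<in> set (transcript A S n) \<Longrightarrow> S' hist h = S hist h"
  shows "transcript A S' n = transcript A S n"
  using assms
proof (induction n)
  case (Suc n)
  have "set (transcript A S n) \<subseteq> set (transcript A S (Suc n))"
    using transcript_append[of A S n 1] by auto
  then have IH: "transcript A S' n = transcript A S n"
    using Suc by (meson subsetD)
  show ?case
  proof (cases "A (map snd (transcript A S n))")
    case (Query h)
    then have "(h, S (transcript A S n) h) \<in> set (transcript A S (Suc n))"
      by (simp add: Let_def)
    from Suc.prems[OF this] show ?thesis using IH Query by (simp add: Let_def)
  qed (use IH in \<open>simp add: Let_def\<close>)
qed simp

section \<open>Measurability of events about runs\<close>

primrec possible_transcripts :: "'x responder \<Rightarrow> nat \<Rightarrow> ('x query \<times> real) list set" where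
  "possible_transcripts S 0 = {[]}"
| "possible_transcripts S (Suc n) = possible_transcripts S n \<union>
     (\<lambda>(ts, h). ts @ [(h, S ts h)]) ` (possible_transcripts S n \<times> UNIV)"

lemma finite_possible_transcripts:
  fixes S :: "'x::finite responder"
  shows "finite (possible_transcripts S n)"
  by (induction n) auto

text \<open>A fixed responder and a finite domain leave finitely many transcripts, the shorter ones
  included because a run may halt early. For each fixed earlier transcript the continuation depends
  on a single step of \<open>A\<close>, so a countable case distinction suffices.\<close>

lemma measurable_transcript:
  fixes A :: "'r \<Rightarrow> 'x::finite stat_alg"
  assumes A: "\<And>as. (\<lambda>\<omega>. A \<omega> as) \<in> measurable M (count_space UNIV)"
  shows "(\<lambda>\<omega>. transcript (A \<omega>) S n) \<in> measurable M (count_space (possible_transcripts S n))"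
proof (induction n)
  case (Suc n)
  let ?next = "\<lambda>ts s. case s of Query h \<Rightarrow> ts @ [(h, S ts h)] | Decide b \<Rightarrow> ts"
  have "(\<lambda>\<omega>. ?next ts (A \<omega> (map snd ts)))
      \<in> measurable M (count_space (possible_transcripts S (Suc n)))"
    if "ts \<in> possible_transcripts S n" for ts
    by (rule measurable_compose[OF A]) (use that in \<open>force split: step.split\<close>)
  from measurable_compose_countable'[OF this Suc countable_finite[OF finite_possible_transcripts]]
  show ?case by (simp add: Let_def)
qed simp

lemma measurable_transcript_event:
  fixes A :: "'r \<Rightarrow> 'x::finite stat_alg"
  assumes A: "\<And>as. (\<lambda>\<omega>. A \<omega> as) \<in> measurable M (count_space UNIV)"
  shows "{\<omega> \<in> space M. Q (transcript (A \<omega>) S n) (A \<omega> (map snd (transcript (A \<omega>) S n)))} \<in> sets M"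
proof -
  have "(\<lambda>\<omega>. Q ts (A \<omega> (map snd ts))) \<in> measurable M (count_space UNIV)" for ts
    by (rule measurable_compose[OF A]) simp
  from measurable_compose_countable'[OF this measurable_transcript[OF A]
      countable_finite[OF finite_possible_transcripts]]
  show ?thesis by (simp add: pred_def)
qed

section \<open>Averages over the input and over the coins\<close>

lemma expectation_average_case_input:
  fixes f :: "'x::finite pmf \<Rightarrow> real"
  assumes "finite \<D>\<^sub>D" "\<D>\<^sub>D \<noteq> {}"
  shows "measure_pmf.expectation (average_case_input D \<D>\<^sub>D) f
    = f D / 2 + (\<Sum>P\<in>\<D>\<^sub>D. f P) / card \<D>\<^sub>D / 2"
  unfolding average_case_input_def
  by (subst pmf_expectation_bind[of UNIV])
    (use assms in \<open>auto simp: UNIV_bool integral_pmf_of_set\<close>)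

text \<open>Double counting: the sum of the probabilities is the expected number of events that
  occur.\<close>

lemma (in prob_space) sum_prob_le:
  assumes "finite I" and meas: "\<And>i. i \<in> I \<Longrightarrow> {\<omega> \<in> space M. Q i \<omega>} \<in> events"
    and card: "\<And>\<omega>. \<omega> \<in> space M \<Longrightarrow> real (card {i \<in> I. Q i \<omega>}) \<le> c"
  shows "(\<Sum>i\<in>I. prob {\<omega> \<in> space M. Q i \<omega>}) \<le> c"
proof -
  let ?ind = "\<lambda>i. indicat_real {\<omega> \<in> space M. Q i \<omega>}"
  have int: "integrable M (?ind i)" if "i \<in> I" for i
    using meas[OF that] by (simp add: integrable_indicator_iff emeasure_eq_measure)
  have sub: "{\<omega> \<in> space M. Q i \<omega>} \<inter> space M = {\<omega> \<in> space M. Q i \<omega>}" for i by blast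
  have "(\<Sum>i\<in>I. prob {\<omega> \<in> space M. Q i \<omega>}) = (\<Sum>i\<in>I. expectation (?ind i))"
    by (simp only: Bochner_Integration.integral_indicator sub)
  also have "\<dots> = expectation (\<lambda>\<omega>. \<Sum>i\<in>I. ?ind i \<omega>)"
    using int by (simp add: Bochner_Integration.integral_sum)
  also have "\<dots> \<le> c"
  proof (rule integral_le_const)
    show "AE \<omega> in M. (\<Sum>i\<in>I. ?ind i \<omega>) \<le> c"
    proof (rule AE_I2)
      fix \<omega> assume "\<omega> \<in> space M"
      then have "(\<Sum>i\<in>I. ?ind i \<omega>) = (\<Sum>i\<in>I. of_bool (Q i \<omega>))"
        by (intro sum.cong) (auto simp: indicator_def)
      also have "\<dots> = real (card {i \<in> I. Q i \<omega>})"
        using \<open>finite I\<close> by (simp add: Int_def)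
      finally show "(\<Sum>i\<in>I. ?ind i \<omega>) \<le> c" using card[OF \<open>\<omega> \<in> space M\<close>] by simp
    qed
  qed (use int in auto)
  finally show ?thesis .
qed

section \<open>Lower bound on the number of calls\<close>

theorem theorem6p1:
  fixes \<D> \<D>\<^sub>D :: "'x::finite pmf set" and D :: "'x pmf"
    and \<kappa> \<gamma> :: real and d q :: nat
    and M :: "'r measure" and A :: "'r \<Rightarrow> 'x stat_alg"
  assumes "\<kappa> > 0"
    and "SDN \<D> D \<kappa> = enat d"
    and "sdn_attained_by \<D> D \<kappa> d \<D>\<^sub>D"
    and "randomized_stat_alg M A"
    and "\<gamma> > 1 / 2"
    and "solves_average_case \<D> D \<D>\<^sub>D (1 / (3 * \<kappa>\<^sup>2)) M A \<gamma>"
    and "calls_at_most (insert D \<D>\<^sub>D) (1 / (3 * \<kappa>\<^sup>2)) M A q"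
  shows "real q \<ge> (2 * \<gamma> - 1) * real d"
proof -
  note transcript.simps(2) [simp del]
  define t where "t = 1 / (3 * \<kappa>\<^sup>2)"
  interpret prob_space M using assms(4) by (simp add: randomized_stat_alg_def)
  have A: "(\<lambda>\<omega>. A \<omega> as) \<in> measurable M (count_space UNIV)" for as
    using assms(4) by (simp add: randomized_stat_alg_def)
  have "D \<notin> \<D>" using finite_SDN_imp_unambiguous assms(1,2) by blast
  have fin: "finite \<D>\<^sub>D" "\<D>\<^sub>D \<noteq> {}" and "\<D>\<^sub>D \<subseteq> \<D>" and "d \<ge> 1"
    using assms(3) by (auto simp: sdn_attained_by_def)
  then have "D \<notin> \<D>\<^sub>D" using \<open>D \<notin> \<D>\<close> by blast
  \<comment> \<open>The exact mean serves as the fallback, being valid for every input.\<close>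
  define S where "S = (\<lambda>P (hist :: ('x query \<times> real) list) h.
    if P \<in> distinguished t D h then query_mean P h else query_mean D h)"
  have exact: "vstat_answer t P h (query_mean P h)" for P h
    using \<open>\<kappa> > 0\<close> by (simp add: vstat_answer_def t_def le_max_iff_disj)
  have valid: "valid_vstat t P (S P)" for P
    using exact by (auto simp: valid_vstat_def S_def distinguished_def)
  have SD: "S D hist h = query_mean D h" for hist h
    by (simp add: S_def)
  \<comment> \<open>With at most \<open>q\<close> calls, the transcript after \<open>Suc q\<close>
    steps is shorter than the number of steps, so the run has halted.\<close>
  let ?ts = "\<lambda>P \<omega>. transcript (A \<omega>) (S P) (Suc q)"
  have calls: "length (?ts P \<omega>) \<le> q" if "P \<in> insert D \<D>\<^sub>D" "\<omega> \<in> space M" for P \<omega>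
    using assms(7) that valid[of P] unfolding calls_at_most_def t_def by blast
  have dec: "decides (A \<omega>) (S P) b \<longleftrightarrow> A \<omega> (map snd (?ts P \<omega>)) = Decide b"
    if "P \<in> insert D \<D>\<^sub>D" "\<omega> \<in> space M" for P \<omega> b
    using calls[OF that] by (intro decides_iff) simp
  \<comment> \<open>The queries are those of the run on \<open>D\<close>; for fixed coins, the same
    at most \<open>q\<close> queries thus serve for all \<open>P\<close> at once.\<close>
  let ?hit = "\<lambda>P \<omega>. \<exists>(h, v) \<in> set (?ts D \<omega>). P \<in> distinguished t D h"
  let ?H = "\<lambda>P. {\<omega> \<in> space M. ?hit P \<omega>}"
  let ?F = "{\<omega> \<in> space M. A \<omega> (map snd (?ts D \<omega>)) = Decide False}"
  have H: "?H P \<in> events" for P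
    by (rule measurable_transcript_event[OF A,
          where Q = "\<lambda>ts _. \<exists>(h, v) \<in> set ts. P \<in> distinguished t D h"])
  have F: "?F \<in> events"
    by (rule measurable_transcript_event[OF A, where Q = "\<lambda>_ s. s = Decide False"])
  let ?succ = "\<lambda>P. {\<omega> \<in> space M. \<exists>b. decides (A \<omega>) (S P) b \<and> correct_decision \<D> D P b}"
  have succ_D: "?succ D = ?F"
    using \<open>D \<notin> \<D>\<close> dec[of D] by (auto simp: correct_decision_def split: if_splits)
  have succ_P: "prob (?succ P) \<le> 1 - prob ?F + prob (?H P)" if P: "P \<in> \<D>\<^sub>D" for P
  proof -
    \<comment> \<open>Without a hit the runs on \<open>P\<close> and \<open>D\<close> coincide, so
      the correct decision \<open>True\<close> on \<open>P\<close> is also taken on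
      \<open>D\<close>, which excludes \<open>?F\<close>.\<close>
    have "?succ P \<subseteq> (space M - ?F) \<union> ?H P"
    proof
      fix \<omega> assume \<omega>: "\<omega> \<in> ?succ P"
      then obtain b where b: "decides (A \<omega>) (S P) b" "correct_decision \<D> D P b" by blast
      have "b" using b(2) P \<open>D \<notin> \<D>\<^sub>D\<close> by (auto simp: correct_decision_def split: if_splits)
      then have T: "A \<omega> (map snd (?ts P \<omega>)) = Decide True"
        using b(1) dec[of P \<omega>] P \<omega> by simp
      have "?ts P \<omega> = ?ts D \<omega>" if "\<not> ?hit P \<omega>"
        by (rule transcript_cong) (use that in \<open>auto simp: SD S_def\<close>)
      then show "\<omega> \<in> (space M - ?F) \<union> ?H P"
        using T \<omega> by (cases "?hit P \<omega>") simp_all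
    qed
    then have "prob (?succ P) \<le> prob ((space M - ?F) \<union> ?H P)"
      using F H by (intro finite_measure_mono) auto
    also have "\<dots> \<le> prob (space M - ?F) + prob (?H P)"
      using F H by (intro measure_Un_le) auto
    finally show ?thesis using prob_compl[OF F] by simp
  qed
  define N where "N = real (card \<D>\<^sub>D)"
  have "N > 0" using fin by (simp add: N_def card_gt_0_iff)
  \<comment> \<open>For each outcome of the coins, a union bound over the distinct queries asked:
    each distinguishes at most N / d members.\<close>
  have sum_H: "(\<Sum>P\<in>\<D>\<^sub>D. prob (?H P)) \<le> q * (N / d)"
  proof (rule sum_prob_le[OF fin(1) H])
    fix \<omega> assume "\<omega> \<in> space M"
    let ?Q = "fst ` set (?ts D \<omega>)"
    have "card ?Q \<le> q"
      using calls[of D \<omega>] \<open>\<omega> \<in> space M\<close>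
      by (meson card_image_le card_length finite_set insertI1 order_trans)
    have "{P \<in> \<D>\<^sub>D. ?hit P \<omega>} = (\<Union>h\<in>?Q. \<D>\<^sub>D \<inter> distinguished t D h)"
      by (auto simp: image_iff split_beta)
    then have "card {P \<in> \<D>\<^sub>D. ?hit P \<omega>} \<le> (\<Sum>h\<in>?Q. card (\<D>\<^sub>D \<inter> distinguished t D h))"
      by (simp only: card_UN_le finite_imageI finite_set)
    then have "real (card {P \<in> \<D>\<^sub>D. ?hit P \<omega>})
        \<le> (\<Sum>h\<in>?Q. real (card (\<D>\<^sub>D \<inter> distinguished t D h)))"
      by (simp only: of_nat_le_iff flip: of_nat_sum)
    also have "\<dots> \<le> (\<Sum>h\<in>?Q. N / d)"
      unfolding N_def t_def by (intro sum_mono card_distinguished[OF assms(3,1)])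
    also have "\<dots> = card ?Q * (N / d)" by simp
    also have "\<dots> \<le> q * (N / d)"
      using \<open>card ?Q \<le> q\<close> \<open>N > 0\<close> by (intro mult_right_mono) auto
    finally show "real (card {P \<in> \<D>\<^sub>D. ?hit P \<omega>}) \<le> q * (N / d)" .
  qed
  define \<sigma> where "\<sigma> = (\<Sum>P\<in>\<D>\<^sub>D. prob (?succ P)) / N"
  have "(\<Sum>P\<in>\<D>\<^sub>D. prob (?succ P)) \<le> (\<Sum>P\<in>\<D>\<^sub>D. 1 - prob ?F + prob (?H P))"
    by (intro sum_mono succ_P)
  also have "\<dots> = N * (1 - prob ?F) + (\<Sum>P\<in>\<D>\<^sub>D. prob (?H P))"
    by (simp only: sum.distrib sum_constant N_def)
  also have "\<dots> \<le> N * (1 - prob ?F + q / d)"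
    using sum_H by (simp add: algebra_simps)
  finally have avg: "\<sigma> \<le> 1 - prob ?F + q / d"
    using \<open>N > 0\<close> by (simp add: \<sigma>_def divide_le_eq mult.commute)
  have "\<gamma> \<le> success_prob \<D> D \<D>\<^sub>D M A S"
    using assms(6) valid unfolding solves_average_case_def t_def by blast
  also have "\<dots> = prob ?F / 2 + \<sigma> / 2"
    unfolding success_prob_def expectation_average_case_input[OF fin] succ_D \<sigma>_def N_def ..
  \<comment> \<open>Success on \<open>D\<close> and failure on unaffected members have the same
    probability \<open>prob ?F\<close>, which cancels in the sum.\<close>
  finally have "2 * \<gamma> - 1 \<le> q / d" using avg by linarith
  then show ?thesis using \<open>d \<ge> 1\<close> by (simp add: le_divide_eq)
qed

end
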